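(* Let $S=\{18,26,30,59,68,70,87,90,91,93,96,99,100\}$. For every $n$ with $1\le n\le 100$ and $n\notin S$, the center $X_n$ lies inside angle $A$ in every isosceles triangle $ABC$ with $b=c>a$. For each $n\in S$, it is not the case that $X_n$ lies inside angle $A$ in every such triangle.
   Context: $X_n$ denotes the $n$-th triangle center listed in Kimberling's Encyclopedia of Triangle Centers (ETC), given by barycentric coordinates in terms of $a=BC$, $b=CA$, $c=AB$. A point is inside angle $A$ if it lies in the open convex region bounded by the rays $AB$ and $AC$; for a point with barycentric coordinates $(u:v:w)$ this holds iff $v(u+v+w)>0$ and $w(u+v+w)>0$. *)

theory Defs
  imports Complex_Main
begin

text \<open>
  Side lengths a = BC, b = CA, c = AB.  Every ETC centre X(n) is encoded by the first
  barycentric coordinate as a quotient  f(a,b,c) / g(a,b,c)  (as listed in ETC); the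
  remaining coordinates are obtained by cyclic permutation (a,b,c) -> (b,c,a) -> (c,a,b).
  To avoid division by zero, the triple of coordinates is taken in the homogeneous,
  denominator-cleared form  (f_A g_B g_C : f_B g_C g_A : f_C g_A g_B), which is the same
  projective point whenever all denominators are nonzero.
\<close>

type_synonym etc_entry = "(real \<Rightarrow> real \<Rightarrow> real \<Rightarrow> real) \<times> (real \<Rightarrow> real \<Rightarrow> real \<Rightarrow> real)"

definition SA :: "real \<Rightarrow> real \<Rightarrow> real \<Rightarrow> real" where
  "SA a b c = (b^2 + c^2 - a^2) / 2"

text \<open>Conway symbol S = twice the area of the triangle (Heron)\<close>
definition Sr :: "real \<Rightarrow> real \<Rightarrow> real \<Rightarrow> real" where
  "Sr a b c = sqrt ((a+b+c)*(-a+b+c)*(a-b+c)*(a+b-c)) / 2"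

text \<open>The angle A opposite side a (law of cosines); angle B is angA b c a, angle C is angA c a b.\<close>
definition angA :: "real \<Rightarrow> real \<Rightarrow> real \<Rightarrow> real" where
  "angA a b c = arccos ((b^2 + c^2 - a^2) / (2*b*c))"

definition bary_of :: "etc_entry \<Rightarrow> real \<Rightarrow> real \<Rightarrow> real \<Rightarrow> real \<times> real \<times> real" where
  "bary_of e a b c =
     (let f = fst e; g = snd e in
       (f a b c * g b c a * g c a b,
        f b c a * g c a b * g a b c,
        f c a b * g a b c * g b c a))"

definition inside_angle_A :: "real \<times> real \<times> real \<Rightarrow> bool" where
  "inside_angle_A p = (case p of (u, v, w) \<Rightarrow> v * (u+v+w) > 0 \<and> w * (u+v+w) > 0)"

definition etc1 :: etc_entry where
  "etc1 = (\<lambda>a b c. a, \<lambda>a b c. 1)"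

definition etc2 :: etc_entry where
  "etc2 = (\<lambda>a b c. 1, \<lambda>a b c. 1)"

definition etc3 :: etc_entry where
  "etc3 = (\<lambda>a b c. a^2*(SA a b c), \<lambda>a b c. 1)"

definition etc4 :: etc_entry where
  "etc4 = (\<lambda>a b c. 1, \<lambda>a b c. (SA a b c))"

definition etc5 :: etc_entry where
  "etc5 = (\<lambda>a b c. (Sr a b c)^2+(SA b c a)*(SA c a b), \<lambda>a b c. 1)"

definition etc6 :: etc_entry where
  "etc6 = (\<lambda>a b c. a^2, \<lambda>a b c. 1)"

definition etc7 :: etc_entry where
  "etc7 = (\<lambda>a b c. 1, \<lambda>a b c. b+c-a)"

definition etc8 :: etc_entry where
  "etc8 = (\<lambda>a b c. b+c-a, \<lambda>a b c. 1)"

definition etc9 :: etc_entry where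
  "etc9 = (\<lambda>a b c. a*(b+c-a), \<lambda>a b c. 1)"

definition etc10 :: etc_entry where
  "etc10 = (\<lambda>a b c. b+c, \<lambda>a b c. 1)"

definition etc11 :: etc_entry where
  "etc11 = (\<lambda>a b c. (b-c)^2*(b+c-a), \<lambda>a b c. 1)"

definition etc12 :: etc_entry where
  "etc12 = (\<lambda>a b c. (b+c)^2, \<lambda>a b c. b+c-a)"

definition etc13 :: etc_entry where
  "etc13 = (\<lambda>a b c. a, \<lambda>a b c. sin((angA a b c)+pi/3))"

definition etc14 :: etc_entry where
  "etc14 = (\<lambda>a b c. a, \<lambda>a b c. sin((angA a b c)-pi/3))"

definition etc15 :: etc_entry where
  "etc15 = (\<lambda>a b c. a*sin((angA a b c)+pi/3), \<lambda>a b c. 1)"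

definition etc16 :: etc_entry where
  "etc16 = (\<lambda>a b c. a*sin((angA a b c)-pi/3), \<lambda>a b c. 1)"

definition etc17 :: etc_entry where
  "etc17 = (\<lambda>a b c. a, \<lambda>a b c. sin((angA a b c)+pi/6))"

definition etc18 :: etc_entry where
  "etc18 = (\<lambda>a b c. a, \<lambda>a b c. sin((angA a b c)-pi/6))"

definition etc19 :: etc_entry where
  "etc19 = (\<lambda>a b c. a, \<lambda>a b c. (SA a b c))"

definition etc20 :: etc_entry where
  "etc20 = (\<lambda>a b c. 3*a^4-2*a^2*(b^2+c^2)-(b^2-c^2)^2, \<lambda>a b c. 1)"

definition etc21 :: etc_entry where
  "etc21 = (\<lambda>a b c. a*(a+b)*(a+c)*(b+c-a), \<lambda>a b c. 1)"

definition etc22 :: etc_entry where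
  "etc22 = (\<lambda>a b c. a^2*(b^4+c^4-a^4), \<lambda>a b c. 1)"

definition etc23 :: etc_entry where
  "etc23 = (\<lambda>a b c. a^2*(b^4+c^4-a^4-b^2*c^2), \<lambda>a b c. 1)"

definition etc24 :: etc_entry where
  "etc24 = (\<lambda>a b c. a*cos(2*(angA a b c)), \<lambda>a b c. cos((angA a b c)))"

definition etc25 :: etc_entry where
  "etc25 = (\<lambda>a b c. a^2, \<lambda>a b c. (SA a b c))"

definition etc26 :: etc_entry where
  "etc26 = (\<lambda>a b c. a^2*(b^2*cos(2*(angA b c a))+c^2*cos(2*(angA c a b))-a^2*cos(2*(angA a b c))), \<lambda>a b c. 1)"

definition etc27 :: etc_entry where
  "etc27 = (\<lambda>a b c. 1, \<lambda>a b c. (b+c)*(SA a b c))"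

definition etc28 :: etc_entry where
  "etc28 = (\<lambda>a b c. a, \<lambda>a b c. (b+c)*(SA a b c))"

definition etc29 :: etc_entry where
  "etc29 = (\<lambda>a b c. a, \<lambda>a b c. cos((angA a b c))*(cos((angA b c a))+cos((angA c a b))))"

definition etc30 :: etc_entry where
  "etc30 = (\<lambda>a b c. 2*a^4-a^2*(b^2+c^2)-(b^2-c^2)^2, \<lambda>a b c. 1)"

definition etc31 :: etc_entry where
  "etc31 = (\<lambda>a b c. a^3, \<lambda>a b c. 1)"

definition etc32 :: etc_entry where
  "etc32 = (\<lambda>a b c. a^4, \<lambda>a b c. 1)"

definition etc33 :: etc_entry where
  "etc33 = (\<lambda>a b c. a*(1+1/cos((angA a b c))), \<lambda>a b c. 1)"

definition etc34 :: etc_entry where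
  "etc34 = (\<lambda>a b c. a*(1-1/cos((angA a b c))), \<lambda>a b c. 1)"

definition etc35 :: etc_entry where
  "etc35 = (\<lambda>a b c. a^2*(b^2+c^2-a^2+b*c), \<lambda>a b c. 1)"

definition etc36 :: etc_entry where
  "etc36 = (\<lambda>a b c. a^2*(b^2+c^2-a^2-b*c), \<lambda>a b c. 1)"

definition etc37 :: etc_entry where
  "etc37 = (\<lambda>a b c. a*(b+c), \<lambda>a b c. 1)"

definition etc38 :: etc_entry where
  "etc38 = (\<lambda>a b c. a*(b^2+c^2), \<lambda>a b c. 1)"

definition etc39 :: etc_entry where
  "etc39 = (\<lambda>a b c. a^2*(b^2+c^2), \<lambda>a b c. 1)"

definition etc40 :: etc_entry where
  "etc40 = (\<lambda>a b c. a*(a^3+a^2*(b+c)-a*(b+c)^2-(b+c)*(b-c)^2), \<lambda>a b c. 1)"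

definition etc41 :: etc_entry where
  "etc41 = (\<lambda>a b c. a^3*(b+c-a), \<lambda>a b c. 1)"

definition etc42 :: etc_entry where
  "etc42 = (\<lambda>a b c. a^2*(b+c), \<lambda>a b c. 1)"

definition etc43 :: etc_entry where
  "etc43 = (\<lambda>a b c. a*(a*b+a*c-b*c), \<lambda>a b c. 1)"

definition etc44 :: etc_entry where
  "etc44 = (\<lambda>a b c. a*(b+c-2*a), \<lambda>a b c. 1)"

definition etc45 :: etc_entry where
  "etc45 = (\<lambda>a b c. a*(2*b+2*c-a), \<lambda>a b c. 1)"

definition etc46 :: etc_entry where
  "etc46 = (\<lambda>a b c. a*(cos((angA b c a))+cos((angA c a b))-cos((angA a b c))), \<lambda>a b c. 1)"

definition etc47 :: etc_entry where
  "etc47 = (\<lambda>a b c. a*cos(2*(angA a b c)), \<lambda>a b c. 1)"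

definition etc48 :: etc_entry where
  "etc48 = (\<lambda>a b c. a*sin(2*(angA a b c)), \<lambda>a b c. 1)"

definition etc49 :: etc_entry where
  "etc49 = (\<lambda>a b c. a*cos(3*(angA a b c)), \<lambda>a b c. 1)"

definition etc50 :: etc_entry where
  "etc50 = (\<lambda>a b c. a*sin(3*(angA a b c)), \<lambda>a b c. 1)"

definition etc51 :: etc_entry where
  "etc51 = (\<lambda>a b c. a^2*((Sr a b c)^2+(SA b c a)*(SA c a b)), \<lambda>a b c. 1)"

definition etc52 :: etc_entry where
  "etc52 = (\<lambda>a b c. a*cos(2*(angA a b c))*cos((angA b c a)-(angA c a b)), \<lambda>a b c. 1)"

definition etc53 :: etc_entry where
  "etc53 = (\<lambda>a b c. a*tan((angA a b c))*cos((angA b c a)-(angA c a b)), \<lambda>a b c. 1)"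

definition etc54 :: etc_entry where
  "etc54 = (\<lambda>a b c. a, \<lambda>a b c. cos((angA b c a)-(angA c a b)))"

definition etc55 :: etc_entry where
  "etc55 = (\<lambda>a b c. a^2*(b+c-a), \<lambda>a b c. 1)"

definition etc56 :: etc_entry where
  "etc56 = (\<lambda>a b c. a^2, \<lambda>a b c. b+c-a)"

definition etc57 :: etc_entry where
  "etc57 = (\<lambda>a b c. a, \<lambda>a b c. b+c-a)"

definition etc58 :: etc_entry where
  "etc58 = (\<lambda>a b c. a^2, \<lambda>a b c. b+c)"

definition etc59 :: etc_entry where
  "etc59 = (\<lambda>a b c. a^2, \<lambda>a b c. (b-c)^2*(b+c-a))"

definition etc60 :: etc_entry where
  "etc60 = (\<lambda>a b c. a^2*(b+c-a), \<lambda>a b c. (b+c)^2)"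

definition etc61 :: etc_entry where
  "etc61 = (\<lambda>a b c. a*sin((angA a b c)+pi/6), \<lambda>a b c. 1)"

definition etc62 :: etc_entry where
  "etc62 = (\<lambda>a b c. a*sin((angA a b c)-pi/6), \<lambda>a b c. 1)"

definition etc63 :: etc_entry where
  "etc63 = (\<lambda>a b c. a*(SA a b c), \<lambda>a b c. 1)"

definition etc64 :: etc_entry where
  "etc64 = (\<lambda>a b c. a^2, \<lambda>a b c. 3*a^4-2*a^2*(b^2+c^2)-(b^2-c^2)^2)"

definition etc65 :: etc_entry where
  "etc65 = (\<lambda>a b c. a*(b+c), \<lambda>a b c. b+c-a)"

definition etc66 :: etc_entry where
  "etc66 = (\<lambda>a b c. 1, \<lambda>a b c. b^4+c^4-a^4)"

definition etc67 :: etc_entry where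
  "etc67 = (\<lambda>a b c. 1, \<lambda>a b c. b^4+c^4-a^4-b^2*c^2)"

definition etc68 :: etc_entry where
  "etc68 = (\<lambda>a b c. a*cos((angA a b c)), \<lambda>a b c. cos(2*(angA a b c)))"

definition etc69 :: etc_entry where
  "etc69 = (\<lambda>a b c. (SA a b c), \<lambda>a b c. 1)"

definition etc70 :: etc_entry where
  "etc70 = (\<lambda>a b c. 1, \<lambda>a b c. b^2*cos(2*(angA b c a))+c^2*cos(2*(angA c a b))-a^2*cos(2*(angA a b c)))"

definition etc71 :: etc_entry where
  "etc71 = (\<lambda>a b c. a^2*(b+c)*(SA a b c), \<lambda>a b c. 1)"

definition etc72 :: etc_entry where
  "etc72 = (\<lambda>a b c. a*(b+c)*(SA a b c), \<lambda>a b c. 1)"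

definition etc73 :: etc_entry where
  "etc73 = (\<lambda>a b c. a^2*(b+c)*(SA a b c), \<lambda>a b c. b+c-a)"

definition etc74 :: etc_entry where
  "etc74 = (\<lambda>a b c. a^2, \<lambda>a b c. 2*a^4-a^2*(b^2+c^2)-(b^2-c^2)^2)"

definition etc75 :: etc_entry where
  "etc75 = (\<lambda>a b c. 1, \<lambda>a b c. a)"

definition etc76 :: etc_entry where
  "etc76 = (\<lambda>a b c. 1, \<lambda>a b c. a^2)"

definition etc77 :: etc_entry where
  "etc77 = (\<lambda>a b c. a, \<lambda>a b c. 1+1/cos((angA a b c)))"

definition etc78 :: etc_entry where
  "etc78 = (\<lambda>a b c. a, \<lambda>a b c. 1-1/cos((angA a b c)))"

definition etc79 :: etc_entry where
  "etc79 = (\<lambda>a b c. 1, \<lambda>a b c. b^2+c^2-a^2+b*c)"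

definition etc80 :: etc_entry where
  "etc80 = (\<lambda>a b c. 1, \<lambda>a b c. b^2+c^2-a^2-b*c)"

definition etc81 :: etc_entry where
  "etc81 = (\<lambda>a b c. a, \<lambda>a b c. b+c)"

definition etc82 :: etc_entry where
  "etc82 = (\<lambda>a b c. a, \<lambda>a b c. b^2+c^2)"

definition etc83 :: etc_entry where
  "etc83 = (\<lambda>a b c. 1, \<lambda>a b c. b^2+c^2)"

definition etc84 :: etc_entry where
  "etc84 = (\<lambda>a b c. a, \<lambda>a b c. a^3+a^2*(b+c)-a*(b+c)^2-(b+c)*(b-c)^2)"

definition etc85 :: etc_entry where
  "etc85 = (\<lambda>a b c. 1, \<lambda>a b c. a*(b+c-a))"

definition etc86 :: etc_entry where
  "etc86 = (\<lambda>a b c. 1, \<lambda>a b c. b+c)"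

definition etc87 :: etc_entry where
  "etc87 = (\<lambda>a b c. a, \<lambda>a b c. a*b+a*c-b*c)"

definition etc88 :: etc_entry where
  "etc88 = (\<lambda>a b c. a, \<lambda>a b c. b+c-2*a)"

definition etc89 :: etc_entry where
  "etc89 = (\<lambda>a b c. a, \<lambda>a b c. 2*b+2*c-a)"

definition etc90 :: etc_entry where
  "etc90 = (\<lambda>a b c. a, \<lambda>a b c. cos((angA b c a))+cos((angA c a b))-cos((angA a b c)))"

definition etc91 :: etc_entry where
  "etc91 = (\<lambda>a b c. a, \<lambda>a b c. cos(2*(angA a b c)))"

definition etc92 :: etc_entry where
  "etc92 = (\<lambda>a b c. a, \<lambda>a b c. sin(2*(angA a b c)))"

definition etc93 :: etc_entry where
  "etc93 = (\<lambda>a b c. a, \<lambda>a b c. cos(3*(angA a b c)))"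

definition etc94 :: etc_entry where
  "etc94 = (\<lambda>a b c. a, \<lambda>a b c. sin(3*(angA a b c)))"

definition etc95 :: etc_entry where
  "etc95 = (\<lambda>a b c. 1, \<lambda>a b c. (Sr a b c)^2+(SA b c a)*(SA c a b))"

definition etc96 :: etc_entry where
  "etc96 = (\<lambda>a b c. a, \<lambda>a b c. cos(2*(angA a b c))*cos((angA b c a)-(angA c a b)))"

definition etc97 :: etc_entry where
  "etc97 = (\<lambda>a b c. a, \<lambda>a b c. tan((angA a b c))*cos((angA b c a)-(angA c a b)))"

definition etc98 :: etc_entry where
  "etc98 = (\<lambda>a b c. 1, \<lambda>a b c. b^4+c^4-a^2*b^2-a^2*c^2)"

definition etc99 :: etc_entry where
  "etc99 = (\<lambda>a b c. 1, \<lambda>a b c. b^2-c^2)"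

definition etc100 :: etc_entry where
  "etc100 = (\<lambda>a b c. a, \<lambda>a b c. b-c)"

definition etc_table :: "etc_entry list" where
  "etc_table = [etc1, etc2, etc3, etc4, etc5, etc6, etc7, etc8, etc9, etc10, etc11, etc12, etc13, etc14, etc15, etc16, etc17, etc18, etc19, etc20, etc21, etc22, etc23, etc24, etc25, etc26, etc27, etc28, etc29, etc30, etc31, etc32, etc33, etc34, etc35, etc36, etc37, etc38, etc39, etc40, etc41, etc42, etc43, etc44, etc45, etc46, etc47, etc48, etc49, etc50, etc51, etc52, etc53, etc54, etc55, etc56, etc57, etc58, etc59, etc60, etc61, etc62, etc63, etc64, etc65, etc66, etc67, etc68, etc69, etc70, etc71, etc72, etc73, etc74, etc75, etc76, etc77, etc78, etc79, etc80, etc81, etc82, etc83, etc84, etc85, etc86, etc87, etc88, etc89, etc90, etc91, etc92, etc93, etc94, etc95, etc96, etc97, etc98, etc99, etc100]"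

definition ETC :: "nat \<Rightarrow> real \<Rightarrow> real \<Rightarrow> real \<Rightarrow> real \<times> real \<times> real" where
  "ETC n a b c = bary_of (etc_table ! (n - 1)) a b c"

end

theory Submission
  imports Defs
begin

text \<open>
  A triangle with \<open>a < b = c\<close> is acute, with apex angle \<open>\<alpha> < \<pi>/3\<close> and base angles
  \<open>\<beta> = (\<pi> - \<alpha>)/2 > \<pi>/3\<close>. Most centres have coordinates of one sign in every triangle or in
  every acute triangle. Any other centre has coordinates \<open>(t x, t y, t y)\<close>, and for \<open>t \<noteq> 0\<close> it lies
  inside angle A as soon as \<open>y\<close> and \<open>x + 2 y\<close> are positive; dividing out \<open>t\<close> makes this visible
  from \<open>a < b\<close> and from the size of \<open>cos \<alpha>\<close> and \<open>cos \<beta>\<close>. Each exceptional centre other than X(30),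
  which is a point at infinity, has a triangle in which its second coordinate vanishes.
\<close>

definition scale_barycentrics :: "real \<Rightarrow> real \<times> real \<times> real \<Rightarrow> real \<times> real \<times> real" where
  "scale_barycentrics t = (\<lambda>(u, v, w). (t * u, t * v, t * w))"

lemma inside_angle_A_scale_barycentrics:
  assumes "t \<noteq> 0"
  shows "inside_angle_A (scale_barycentrics t P) \<longleftrightarrow> inside_angle_A P"
proof -
  obtain u v w where P_eq: "P = (u, v, w)"
    by (cases P)
  have "0 < t^2 * z \<longleftrightarrow> 0 < z" for z
    using assms by (simp add: zero_less_mult_iff)
  moreover have "t * x * (t * u + t * v + t * w) = t^2 * (x * (u + v + w))" for x
    by (simp add: power2_eq_square algebra_simps)
  ultimately show ?thesis
    by (simp only: P_eq inside_angle_A_def scale_barycentrics_def prod.case)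
qed

lemma inside_angle_A_if_nonneg_pos_pos:
  assumes "0 \<le> u" "0 < v" "0 < w"
  shows "inside_angle_A (u, v, w)"
  using assms by (simp add: inside_angle_A_def)

lemma inside_angle_A_scaled_symmetric:
  assumes "t \<noteq> 0" "0 < y" "0 < x + 2 * y"
  shows "inside_angle_A (scale_barycentrics t (x, y, y))"
  unfolding inside_angle_A_scale_barycentrics[OF assms(1)]
  using assms(2,3) by (simp add: inside_angle_A_def)

lemma bary_of_eq_scaled_quotients:
  assumes "g a b c \<noteq> 0" "g b c a \<noteq> 0" "g c a b \<noteq> 0"
  shows "bary_of (f, g) a b c = scale_barycentrics (g a b c * g b c a * g c a b)
    (f a b c / g a b c, f b c a / g b c a, f c a b / g c a b)"
  using assms by (simp add: bary_of_def scale_barycentrics_def)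

lemma inside_angle_A_bary_of_pos:
  assumes "0 \<le> f a b c" "0 < f b c a" "0 < f c a b"
    and "0 < g a b c" "0 < g b c a" "0 < g c a b"
  shows "inside_angle_A (bary_of (f, g) a b c)"
  unfolding bary_of_def Let_def fst_conv snd_conv
  using assms by (intro inside_angle_A_if_nonneg_pos_pos) simp_all

lemma inside_angle_A_bary_of_neg:
  assumes "g a b c \<noteq> 0" "g b c a \<noteq> 0" "g c a b \<noteq> 0"
    and "f a b c / g a b c < 0" "f b c a / g b c a < 0" "f c a b / g c a b < 0"
  shows "inside_angle_A (bary_of (f, g) a b c)"
proof -
  have "inside_angle_A (f a b c / g a b c, f b c a / g b c a, f c a b / g c a b)"
    using assms(4-6) unfolding inside_angle_A_def prod.case
    by (intro conjI mult_neg_neg add_neg_neg)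
  then show ?thesis
    using assms(1-3) by (simp add: bary_of_eq_scaled_quotients inside_angle_A_scale_barycentrics)
qed

lemma not_inside_angle_A_bary_of:
  assumes "f b c a * g c a b * g a b c = 0"
  shows "\<not> inside_angle_A (bary_of (f, g) a b c)"
  using assms by (auto simp: inside_angle_A_def bary_of_def)

lemma angA_commute: "angA a c b = angA a b c"
  by (simp add: angA_def ac_simps)

lemmas ETC_entry = ETC_def etc_table_def

lemmas etc_defs =
  etc1_def etc2_def etc3_def etc4_def etc5_def etc6_def etc7_def etc8_def etc9_def etc10_def
  etc11_def etc12_def etc13_def etc14_def etc15_def etc16_def etc17_def etc18_def etc19_def
  etc20_def etc21_def etc22_def etc23_def etc24_def etc25_def etc26_def etc27_def etc28_def
  etc29_def etc30_def etc31_def etc32_def etc33_def etc34_def etc35_def etc36_def etc37_def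
  etc38_def etc39_def etc40_def etc41_def etc42_def etc43_def etc44_def etc45_def etc46_def
  etc47_def etc48_def etc49_def etc50_def etc51_def etc52_def etc53_def etc54_def etc55_def
  etc56_def etc57_def etc58_def etc59_def etc60_def etc61_def etc62_def etc63_def etc64_def
  etc65_def etc66_def etc67_def etc68_def etc69_def etc70_def etc71_def etc72_def etc73_def
  etc74_def etc75_def etc76_def etc77_def etc78_def etc79_def etc80_def etc81_def etc82_def
  etc83_def etc84_def etc85_def etc86_def etc87_def etc88_def etc89_def etc90_def etc91_def
  etc92_def etc93_def etc94_def etc95_def etc96_def etc97_def etc98_def etc99_def etc100_def

subsection \<open>Centres inside angle A in every triangle or every acute triangle\<close>

definition triangle :: "real \<Rightarrow> real \<Rightarrow> real \<Rightarrow> bool" where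
  "triangle a b c \<longleftrightarrow> a < b + c \<and> b < c + a \<and> c < a + b"

lemma triangle_sides_pos:
  assumes "triangle a b c"
  shows "0 < a" "0 < b" "0 < c"
  using assms by (auto simp: triangle_def)

lemma inside_angle_A_triangle:
  assumes "triangle a b c"
  shows "\<forall>n\<in>{1, 2, 6, 7, 8, 9, 10, 12, 21, 31, 32, 37, 38, 39, 41, 42, 45, 55, 56, 57, 58, 60, 65,
    75, 76, 81, 82, 83, 85, 86, 89}. inside_angle_A (ETC n a b c)"
  using triangle_sides_pos[OF assms] assms[unfolded triangle_def]
  by (simp add: ETC_entry, unfold etc_defs,
      intro conjI inside_angle_A_bary_of_pos less_imp_le[of 0] zero_less_one mult_pos_pos
        add_pos_pos zero_less_power)
    auto

definition acute_triangle :: "real \<Rightarrow> real \<Rightarrow> real \<Rightarrow> bool" where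
  "acute_triangle a b c \<longleftrightarrow> triangle a b c \<and> 0 < SA a b c \<and> 0 < SA b c a \<and> 0 < SA c a b"

lemma acute_triangle_rotations:
  assumes "acute_triangle a b c"
  shows "acute_triangle a b c" "acute_triangle b c a" "acute_triangle c a b"
  using assms by (auto simp: acute_triangle_def triangle_def)

lemma cosine_law_quotient_less_1:
  assumes "triangle a b c"
  shows "(b^2 + c^2 - a^2) / (2 * b * c) < 1"
proof -
  have "0 < (a + b - c) * (a + c - b)"
    using assms by (intro mult_pos_pos) (auto simp: triangle_def)
  then have "b^2 + c^2 - a^2 < 2 * b * c"
    by (simp add: power2_eq_square algebra_simps)
  then show ?thesis
    using triangle_sides_pos[OF assms] by simp
qed

lemma angA_acute:
  assumes "acute_triangle a b c"
  shows "0 < angA a b c" "angA a b c < pi / 2"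
proof -
  let ?q = "(b^2 + c^2 - a^2) / (2 * b * c)"
  have "triangle a b c" "0 < SA a b c"
    using assms by (simp_all add: acute_triangle_def)
  then have "0 < ?q" "?q < 1"
    using triangle_sides_pos cosine_law_quotient_less_1 by (simp_all add: SA_def)
  then have "arccos 1 < arccos ?q" "arccos ?q < arccos 0"
    by (intro arccos_less_arccos; simp)+
  then show "0 < angA a b c" "angA a b c < pi / 2"
    by (simp_all add: angA_def)
qed

lemma cos_angA_acute:
  assumes "acute_triangle a b c"
  shows "0 < cos (angA a b c)" "cos (angA a b c) < 1"
proof -
  show "0 < cos (angA a b c)"
    using angA_acute[OF assms] by (intro cos_gt_zero_pi) simp_all
  have "cos (angA a b c) < cos 0"
    using angA_acute[OF assms] by (intro cos_monotone_0_pi) simp_all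
  then show "cos (angA a b c) < 1"
    by simp
qed

lemma inside_angle_A_acute_triangle_polynomial:
  assumes "acute_triangle a b c"
  shows "\<forall>n\<in>{3, 4, 5, 19, 25, 27, 28, 35, 51, 63, 69, 71, 72, 73, 79, 95}.
    inside_angle_A (ETC n a b c)"
proof -
  have "0 < y^2 + z^2 - x^2 + y * z" if "acute_triangle x y z" for x y z
    using that triangle_sides_pos[of x y z]
    by (simp add: acute_triangle_def SA_def add_pos_pos)
  note X35_X79_factor_pos = acute_triangle_rotations[OF assms, THEN this]
  show ?thesis
    using assms X35_X79_factor_pos
    by (simp add: ETC_entry, unfold etc_defs, intro conjI inside_angle_A_bary_of_pos)
      (auto simp: add_nonneg_pos acute_triangle_def triangle_sides_pos triangle_def)
qed

lemma inside_angle_A_acute_triangle_trigonometric: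
  assumes "acute_triangle a b c"
  shows "\<forall>n\<in>{13, 15, 17, 29, 33, 48, 53, 54, 61, 77, 92, 97}. inside_angle_A (ETC n a b c)"
proof -
  note angle_bounds = acute_triangle_rotations[OF assms, THEN angA_acute(1)]
    acute_triangle_rotations[OF assms, THEN angA_acute(2)]
  have "triangle a b c"
    using assms by (simp add: acute_triangle_def)
  note triangle_sides_pos[OF this]
  with angle_bounds pi_gt_zero show ?thesis
    by (simp add: ETC_entry, unfold etc_defs,
        intro conjI inside_angle_A_bary_of_pos less_imp_le[of 0] zero_less_one mult_pos_pos
          add_pos_pos divide_pos_pos sin_gt_zero cos_gt_zero_pi tan_gt_zero)
      (linarith | simp)+
qed

lemma inside_angle_A_acute_triangle_secant:
  assumes "acute_triangle a b c"
  shows "\<forall>n\<in>{34, 78}. inside_angle_A (ETC n a b c)"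
proof -
  have "0 < x \<and> 1 - 1 / cos (angA x y z) < 0" if "acute_triangle x y z" for x y z
    using that cos_angA_acute[OF that] triangle_sides_pos[of x y z]
    by (simp add: acute_triangle_def)
  note secant_signs = acute_triangle_rotations[OF assms, THEN this]
  show ?thesis
    by (simp add: ETC_entry, unfold etc_defs, intro conjI inside_angle_A_bary_of_neg)
      (use secant_signs in \<open>auto simp: mult_less_0_iff divide_less_0_iff\<close>)
qed

subsection \<open>Isosceles triangles\<close>

lemma ETC_isosceles_polynomial:
  "ETC 11 a b b = scale_barycentrics (a * (a - b)^2) (0, 1, 1)"
  "ETC 20 a b b = scale_barycentrics (-(a^2)) (4 * b^2 - 3 * a^2, a^2, a^2)"
  "ETC 22 a b b = scale_barycentrics (a^2) (2 * b^4 - a^4, a^2 * b^2, a^2 * b^2)"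
  "ETC 23 a b b = scale_barycentrics (a^2 * (a^2 - b^2)) (-(a^2 + b^2), b^2, b^2)"
  "ETC 36 a b b = scale_barycentrics (a * (a - b)) (-(a^2 + a * b), b^2, b^2)"
  "ETC 40 a b b = scale_barycentrics (-(a^2)) (4 * b^2 - 2 * (a * b) - a^2, a * b, a * b)"
  "ETC 43 a b b = scale_barycentrics b (2 * a^2 - a * b, b^2, b^2)"
  "ETC 44 a b b = scale_barycentrics (a - b) (- 2 * a, b, b)"
  "ETC 64 a b b = scale_barycentrics (a^6)
    (a^4, b^2 * (4 * b^2 - 3 * a^2), b^2 * (4 * b^2 - 3 * a^2))"
  "ETC 66 a b b = scale_barycentrics (a^4) (a^4, 2 * b^4 - a^4, 2 * b^4 - a^4)"
  "ETC 67 a b b = scale_barycentrics (-(a^2 * (a^2 - b^2)^2)) (-(a^2), a^2 + b^2, a^2 + b^2)"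
  "ETC 74 a b b = scale_barycentrics (-(a^4 * (a^2 - b^2)^2)) (-(a^2), 2 * b^2, 2 * b^2)"
  "ETC 80 a b b = scale_barycentrics (-(a * (a - b)^2)) (- a, a + b, a + b)"
  "ETC 84 a b b = scale_barycentrics (a^4)
    (a^3, b * (4 * b^2 - 2 * (a * b) - a^2), b * (4 * b^2 - 2 * (a * b) - a^2))"
  "ETC 88 a b b = scale_barycentrics (-((a - b)^2)) (- a, 2 * b, 2 * b)"
  "ETC 98 a b b = scale_barycentrics (-(a^2 * (a^2 - b^2)^2)) (-(a^2), 2 * b^2, 2 * b^2)"
  by (simp_all add: ETC_entry bary_of_def scale_barycentrics_def etc_defs, algebra+)

locale isosceles_triangle =
  fixes a b :: real
  assumes a_pos: "0 < a" and a_less_2b: "a < 2 * b"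
begin

abbreviation apex_angle :: real (\<open>\<alpha>\<close>) where "\<alpha> \<equiv> angA a b b"

abbreviation base_angle :: real (\<open>\<beta>\<close>) where "\<beta> \<equiv> angA b b a"

lemma b_pos: "0 < b"
  using a_pos a_less_2b by simp

lemma base_angle_eq: "\<beta> = arccos (a / (2 * b))"
proof -
  have "(b^2 + a^2 - b^2) / (2 * b * a) = a / (2 * b)"
    using a_pos by (simp add: power2_eq_square)
  then show ?thesis
    by (simp add: angA_def)
qed

lemma cos_base_angle: "cos \<beta> = a / (2 * b)"
  using a_pos a_less_2b by (simp add: base_angle_eq cos_arccos field_simps)

lemma base_eq_cos: "a = 2 * b * cos \<beta>"
  using b_pos by (simp add: cos_base_angle)

lemma base_angle_acute: "0 < \<beta>" "\<beta> < pi / 2"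
proof -
  have "arccos 1 < arccos (a / (2 * b))" "arccos (a / (2 * b)) < arccos 0"
    using a_pos a_less_2b by (intro arccos_less_arccos; simp add: field_simps)+
  then show "0 < \<beta>" "\<beta> < pi / 2"
    by (simp_all add: base_angle_eq)
qed

lemma apex_angle_eq: "\<alpha> = pi - 2 * \<beta>"
proof -
  have "(b^2 + b^2 - a^2) / (2 * b * b) = 1 - 2 * (cos \<beta>)^2"
    using b_pos by (simp add: cos_base_angle field_simps power2_eq_square)
  also have "\<dots> = cos (pi - 2 * \<beta>)"
    by (simp add: cos_double_cos)
  finally show ?thesis
    using base_angle_acute unfolding angA_def[of a] by (simp only: arccos_cos)
qed

lemma cos_apex_angle: "cos \<alpha> = 1 - 2 * (cos \<beta>)^2"
  by (simp add: apex_angle_eq cos_double_cos)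

lemma multiple_angles:
  "cos (2 * \<alpha>) = 2 * (cos \<alpha>)^2 - 1" "cos (2 * \<beta>) = - cos \<alpha>"
  "cos (3 * \<alpha>) = 1 - 2 * (cos (3 * \<beta>))^2" "cos (3 * \<beta>) = - (1 + 2 * cos \<alpha>) * cos \<beta>"
  "sin (3 * \<alpha>) = 2 * sin (3 * \<beta>) * cos (3 * \<beta>)"
  "cos (\<alpha> - \<beta>) = (1 + 2 * cos \<alpha>) * cos \<beta>" "cos (\<beta> - \<alpha>) = (1 + 2 * cos \<alpha>) * cos \<beta>"
  "sin (\<alpha> - pi / 3) = - 2 * sin (\<beta> - pi / 3) * cos (\<beta> - pi / 3)"
proof -
  show "cos (2 * \<alpha>) = 2 * (cos \<alpha>)^2 - 1"
    by (rule cos_double_cos)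
  show "cos (2 * \<beta>) = - cos \<alpha>"
    by (simp add: apex_angle_eq)
  show triple: "cos (3 * \<beta>) = - (1 + 2 * cos \<alpha>) * cos \<beta>"
    by (simp add: cos_treble_cos cos_apex_angle power2_eq_square power3_eq_cube algebra_simps)
  have "3 * \<alpha> = pi - 2 * (3 * \<beta>) + 2 * pi"
    by (simp add: apex_angle_eq)
  then show "cos (3 * \<alpha>) = 1 - 2 * (cos (3 * \<beta>))^2"
    "sin (3 * \<alpha>) = 2 * sin (3 * \<beta>) * cos (3 * \<beta>)"
    by (simp_all only: cos_periodic sin_periodic cos_pi_minus sin_pi_minus
        cos_double_cos sin_double minus_diff_eq)
  have "\<alpha> - \<beta> = pi - 3 * \<beta>"
    by (simp add: apex_angle_eq)
  then show "cos (\<alpha> - \<beta>) = (1 + 2 * cos \<alpha>) * cos \<beta>"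
    by (simp only: cos_pi_minus triple minus_mult_left minus_minus)
  then show "cos (\<beta> - \<alpha>) = (1 + 2 * cos \<alpha>) * cos \<beta>"
    by (metis cos_minus minus_diff_eq)
  have "\<alpha> - pi / 3 = - (2 * (\<beta> - pi / 3))"
    by (simp add: apex_angle_eq)
  then show "sin (\<alpha> - pi / 3) = - 2 * sin (\<beta> - pi / 3) * cos (\<beta> - pi / 3)"
    by (simp only: sin_minus sin_double)
qed

lemma ETC_isosceles_trigonometric:
  "ETC 14 a b b = scale_barycentrics (-((sin (\<beta> - pi / 3))^2))
    (- a, 2 * b * cos (\<beta> - pi / 3), 2 * b * cos (\<beta> - pi / 3))"
  "ETC 16 a b b = scale_barycentrics (sin (\<beta> - pi / 3)) (- 2 * a * cos (\<beta> - pi / 3), b, b)"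
  "ETC 24 a b b = scale_barycentrics (-(b * cos \<beta>))
    ((1 - cos \<alpha>) * (1 - 2 * (cos \<alpha>)^2), (cos \<alpha>)^2, (cos \<alpha>)^2)"
  "ETC 46 a b b = scale_barycentrics b (2 * cos \<beta> * (2 * cos \<beta> - cos \<alpha>), cos \<alpha>, cos \<alpha>)"
  "ETC 47 a b b = scale_barycentrics (- b) (2 * cos \<beta> * (1 - 2 * (cos \<alpha>)^2), cos \<alpha>, cos \<alpha>)"
  "ETC 49 a b b = scale_barycentrics (-(b * cos \<beta>))
    (4 * (cos (3 * \<beta>))^2 - 2, 1 + 2 * cos \<alpha>, 1 + 2 * cos \<alpha>)"
  "ETC 50 a b b = scale_barycentrics (b * sin (3 * \<beta>))
    (- 2 * (1 - cos \<alpha>) * (1 + 2 * cos \<alpha>), 1, 1)"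
  "ETC 52 a b b = scale_barycentrics (-(b * cos \<beta>))
    (2 - 4 * (cos \<alpha>)^2, cos \<alpha> * (1 + 2 * cos \<alpha>), cos \<alpha> * (1 + 2 * cos \<alpha>))"
  "ETC 94 a b b = scale_barycentrics (-(a * (sin (3 * \<beta>))^2))
    (-1, 1 + 2 * cos \<alpha>, 1 + 2 * cos \<alpha>)"
  by (simp_all add: ETC_entry, unfold etc_defs)
    (simp_all add: bary_of_def scale_barycentrics_def angA_commute[of b a b] multiple_angles,
      (algebra | use base_eq_cos cos_apex_angle in algebra)+)

end

locale tall_isosceles_triangle =
  fixes a b :: real
  assumes a_pos: "0 < a" and a_less_b: "a < b"
begin

sublocale isosceles_triangle
  using a_pos a_less_b by unfold_locales simp_all

lemma tall_isosceles_acute: "acute_triangle a b b"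
proof -
  have "a^2 < b^2"
    using a_pos a_less_b by (intro power_strict_mono) simp_all
  moreover have "0 < a^2"
    using a_pos by simp
  ultimately have "a^2 < 2 * b^2"
    by linarith
  then show ?thesis
    using a_pos a_less_2b by (simp add: acute_triangle_def triangle_def SA_def)
qed

lemma inside_angle_A_tall_isosceles_polynomial:
  "\<forall>n\<in>{11, 20, 22, 23, 36, 40, 43, 44, 64, 66, 67, 74, 80, 84, 88, 98}.
    inside_angle_A (ETC n a b b)"
proof -
  have quadratic: "a^2 < a * b" "a * b < b^2" "0 < a^2"
    using a_pos a_less_b by (simp_all add: power2_eq_square)
  then have nonzero: "a^2 - b^2 \<noteq> 0" "a - b \<noteq> 0"
    using a_less_b by linarith+
  have "a^4 < b^4" "b^4 < 2 * b^4" "b^4 < 4 * b^4"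
    using a_pos a_less_b by (simp_all add: power_strict_mono)
  then have factors_pos: "a^4 < 4 * b^4" "0 < 2 * b^4 - a^4" "0 < 4 * b^2 - 3 * a^2"
    "0 < 4 * b^2 - 2 * (a * b) - a^2"
    using quadratic by linarith+
  show ?thesis
    unfolding ball_simps ETC_isosceles_polynomial
    using a_pos a_less_b b_pos quadratic factors_pos
    by (intro conjI TrueI inside_angle_A_scaled_symmetric)
      ((simp add: nonzero add_pos_pos; fail) | linarith)+
qed

lemma base_angle_gt_pi_third: "pi / 3 < \<beta>"
proof -
  have "cos \<beta> < cos (pi / 3)"
    using a_less_b b_pos by (simp add: cos_base_angle cos_60)
  then show ?thesis
    using base_angle_acute by (simp add: cos_mono_less_eq)
qed

lemma angle_value_bounds:
  "0 < cos \<beta>" "cos \<beta> < 1 / 2" "1 / 2 < cos \<alpha>" "cos \<alpha> < 1" "sin (3 * \<beta>) < 0"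
  "0 < sin (\<beta> - pi / 3)" "1 / 2 < cos (\<beta> - pi / 3)"
proof -
  show base_cos_bounds: "0 < cos \<beta>" "cos \<beta> < 1 / 2"
    using a_pos a_less_b by (simp_all add: cos_base_angle)
  then have "(cos \<beta>)^2 < (1 / 2)^2"
    by (intro power_strict_mono) simp_all
  with base_cos_bounds show "1 / 2 < cos \<alpha>" "cos \<alpha> < 1"
    by (simp_all add: cos_apex_angle power2_eq_square)
  have "0 < sin (3 * \<beta> - pi)"
    using base_angle_gt_pi_third base_angle_acute
    by (intro sin_gt_zero) simp_all
  then show "sin (3 * \<beta>) < 0"
    by simp
  show "0 < sin (\<beta> - pi / 3)"
    using base_angle_gt_pi_third base_angle_acute by (intro sin_gt_zero) simp_all
  have "cos (pi / 3) < cos (\<beta> - pi / 3)"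
    using base_angle_gt_pi_third base_angle_acute by (intro cos_monotone_0_pi) simp_all
  then show "1 / 2 < cos (\<beta> - pi / 3)"
    by (simp add: cos_60)
qed

lemma apex_cosine_polynomials_pos:
  "0 < (1 - cos \<alpha>) * (1 - 2 * (cos \<alpha>)^2) + 2 * (cos \<alpha>)^2"
  "0 < - 2 * (1 - cos \<alpha>) * (1 + 2 * cos \<alpha>) + 2 * 1"
  "0 < 2 - 4 * (cos \<alpha>)^2 + 2 * (cos \<alpha> * (1 + 2 * cos \<alpha>))"
proof -
  have "(1 - cos \<alpha>) * (1 - 2 * (cos \<alpha>)^2) + 2 * (cos \<alpha>)^2 = (1 - cos \<alpha>) + 2 * (cos \<alpha>)^3"
    by algebra
  also have "0 < \<dots>"
    using angle_value_bounds by (intro add_pos_pos) simp_all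
  finally show "0 < (1 - cos \<alpha>) * (1 - 2 * (cos \<alpha>)^2) + 2 * (cos \<alpha>)^2" .
  have "- 2 * (1 - cos \<alpha>) * (1 + 2 * cos \<alpha>) + 2 * 1 = 2 * cos \<alpha> * (2 * cos \<alpha> - 1)"
    by algebra
  also have "0 < \<dots>"
    using angle_value_bounds by (intro mult_pos_pos) simp_all
  finally show "0 < - 2 * (1 - cos \<alpha>) * (1 + 2 * cos \<alpha>) + 2 * 1" .
  have "2 - 4 * (cos \<alpha>)^2 + 2 * (cos \<alpha> * (1 + 2 * cos \<alpha>)) = 2 + 2 * cos \<alpha>"
    by algebra
  also have "0 < \<dots>"
    using angle_value_bounds by simp
  finally show "0 < 2 - 4 * (cos \<alpha>)^2 + 2 * (cos \<alpha> * (1 + 2 * cos \<alpha>))" .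
qed

lemma base_cosine_polynomials_pos:
  "0 < 2 * cos \<beta> * (2 * cos \<beta> - cos \<alpha>) + 2 * cos \<alpha>"
  "0 < 2 * cos \<beta> * (1 - 2 * (cos \<alpha>)^2) + 2 * cos \<alpha>"
proof -
  have "2 * cos \<beta> * (2 * cos \<beta> - cos \<alpha>) + 2 * cos \<alpha>
      = 4 * (cos \<beta>)^2 + 2 * cos \<alpha> * (1 - cos \<beta>)"
    by algebra
  also have "0 < \<dots>"
    using angle_value_bounds by (intro add_nonneg_pos) simp_all
  finally show "0 < 2 * cos \<beta> * (2 * cos \<beta> - cos \<alpha>) + 2 * cos \<alpha>" .
  have "2 * cos \<beta> * (1 - 2 * (cos \<alpha>)^2) + 2 * cos \<alpha>
      = 2 * (cos \<beta> * (1 - cos \<alpha>) * (1 + cos \<alpha>) + cos \<alpha> * (1 - cos \<beta> * cos \<alpha>))"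
    by algebra
  also have "0 < \<dots>"
    using angle_value_bounds mult_le_one[of "cos \<beta>" "cos \<alpha>"]
    by (intro mult_pos_pos add_pos_nonneg) simp_all
  finally show "0 < 2 * cos \<beta> * (1 - 2 * (cos \<alpha>)^2) + 2 * cos \<alpha>" .
qed

lemma second_fermat_and_isodynamic_sums_pos:
  "0 < - a + 2 * (2 * b * cos (\<beta> - pi / 3))"
  "0 < - 2 * a * cos (\<beta> - pi / 3) + 2 * b"
proof -
  have "b < b * (2 * cos (\<beta> - pi / 3))"
    using b_pos angle_value_bounds by simp
  then show "0 < - a + 2 * (2 * b * cos (\<beta> - pi / 3))"
    using a_less_2b by simp
  have "a * cos (\<beta> - pi / 3) \<le> a * 1"
    using a_pos by (intro mult_left_mono) simp_all
  then show "0 < - 2 * a * cos (\<beta> - pi / 3) + 2 * b"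
    using a_less_b by simp
qed

lemma inside_angle_A_tall_isosceles_trigonometric:
  "\<forall>n\<in>{14, 16, 24, 46, 47, 49, 50, 52, 94}. inside_angle_A (ETC n a b b)"
  unfolding ball_simps ETC_isosceles_trigonometric
  using apex_cosine_polynomials_pos base_cosine_polynomials_pos second_fermat_and_isodynamic_sums_pos
    angle_value_bounds a_pos b_pos
  by (intro conjI TrueI inside_angle_A_scaled_symmetric) (simp_all add: add_pos_pos add_nonneg_pos)

lemma inside_angle_A_ETC_62: "inside_angle_A (ETC 62 a b b)"
proof -
  have half: "1 / 2 < sin (\<beta> - pi / 6)"
    using base_angle_gt_pi_third base_angle_acute sin_monotone_2pi[of "pi / 6" "\<beta> - pi / 6"]
    by (simp add: sin_30)
  have "a * (- 1) \<le> a * sin (\<alpha> - pi / 6)"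
    using a_pos by (intro mult_left_mono) auto
  moreover have "b * (1 / 2) < b * sin (\<beta> - pi / 6)"
    using b_pos half by (intro mult_strict_left_mono) auto
  ultimately have "0 < a * sin (\<alpha> - pi / 6) + 2 * (b * sin (\<beta> - pi / 6))"
    using a_less_b by linarith
  then have "inside_angle_A
      (scale_barycentrics 1 (a * sin (\<alpha> - pi / 6), b * sin (\<beta> - pi / 6), b * sin (\<beta> - pi / 6)))"
    using b_pos half by (intro inside_angle_A_scaled_symmetric) simp_all
  then show ?thesis
    by (simp add: ETC_entry etc62_def bary_of_def scale_barycentrics_def
        angA_commute[of b a b])
qed

lemma unexceptional_center_inside_angle_A:
  assumes "n \<in> {1..100} - {18,26,30,59,68,70,87,90,91,93,96,99,100}"
  shows "inside_angle_A (ETC n a b b)"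
proof -
  have "triangle a b b"
    using tall_isosceles_acute by (simp add: acute_triangle_def)
  note inside = inside_angle_A_triangle[OF this]
    inside_angle_A_acute_triangle_polynomial[OF tall_isosceles_acute]
    inside_angle_A_acute_triangle_trigonometric[OF tall_isosceles_acute]
    inside_angle_A_acute_triangle_secant[OF tall_isosceles_acute]
    inside_angle_A_tall_isosceles_polynomial inside_angle_A_tall_isosceles_trigonometric
    inside_angle_A_ETC_62
  have "list_all (\<lambda>n. n \<notin> {18,26,30,59,68,70,87,90,91,93,96,99,100} \<longrightarrow>
    inside_angle_A (ETC n a b b)) [1..<101]"
    using inside by (simp add: upt_rec[of "Suc 0"] numeral_2_eq_2[symmetric])
  then show ?thesis
    using assms by (auto simp: list_all_iff)
qed

end

subsection \<open>Exceptional centres\<close>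

lemma tall_isosceles_triangle_apex:
  fixes \<alpha> :: real
  assumes "0 < \<alpha>" "\<alpha> < pi / 3"
  obtains a where "tall_isosceles_triangle a 1" "angA a 1 1 = \<alpha>"
proof
  have "sin (\<alpha> / 2) < sin (pi / 6)"
    using assms by (intro sin_monotone_2pi) simp_all
  moreover have "0 < sin (\<alpha> / 2)"
    using assms by (intro sin_gt_zero) simp_all
  ultimately show "tall_isosceles_triangle (2 * sin (\<alpha> / 2)) 1"
    by unfold_locales (simp_all add: sin_30)
  have "cos \<alpha> = 1 - 2 * (sin (\<alpha> / 2))^2"
    using cos_double_sin[of "\<alpha> / 2"] by simp
  then have "(1^2 + 1^2 - (2 * sin (\<alpha> / 2))^2) / (2 * 1 * 1) = cos \<alpha>"
    by (simp add: power_mult_distrib)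
  then show "angA (2 * sin (\<alpha> / 2)) 1 1 = \<alpha>"
    using assms unfolding angA_def by (simp only: arccos_cos)
qed

lemma not_inside_angle_A_isosceles:
  "\<forall>n\<in>{59, 99, 100}. \<not> inside_angle_A (ETC n a b b)"
  by (simp add: ETC_entry etc_defs not_inside_angle_A_bary_of)

lemma not_inside_angle_A_ETC_30: "\<not> inside_angle_A (ETC 30 a b c)"
proof -
  obtain u v w where coords: "ETC 30 a b c = (u, v, w)"
    by (cases "ETC 30 a b c")
  then have "u + v + w = 0"
    by (auto simp: ETC_entry etc30_def bary_of_def algebra_simps power2_eq_square
        power4_eq_xxxx)
  with coords show ?thesis
    by (simp add: inside_angle_A_def)
qed

lemma not_inside_angle_A_ETC_87: "\<not> inside_angle_A (ETC 87 1 2 2)"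
  by (simp add: ETC_entry etc87_def not_inside_angle_A_bary_of)

lemma not_inside_angle_A_ETC_90:
  fixes b :: real
  assumes "isosceles_triangle a b" "(a + b)^2 = 3 * b^2"
  shows "\<not> inside_angle_A (ETC 90 a b b)"
proof -
  interpret isosceles_triangle a b by fact
  have "2 * cos \<beta> = cos \<alpha>"
    using assms(2) b_pos
    by (simp add: cos_apex_angle cos_base_angle power2_eq_square field_simps)
  then show ?thesis
    by (simp add: ETC_entry etc90_def not_inside_angle_A_bary_of
        angA_commute[of b a b])
qed

lemma not_inside_angle_A_apex_pi_6:
  assumes "angA a b c = pi / 6"
  shows "\<forall>n\<in>{18, 93}. \<not> inside_angle_A (ETC n a b c)"
  by (simp add: ETC_entry etc_defs not_inside_angle_A_bary_of assms)

text \<open>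
  For X(70) it is the denominators at B and C that vanish here, so the cleared triple
  degenerates to \<open>(0, 0, 0)\<close>; in every other triangle with \<open>a < b = c\<close> it lies inside angle A.
\<close>

lemma not_inside_angle_A_apex_pi_4:
  assumes "angA a b b = pi / 4"
  shows "\<forall>n\<in>{26, 68, 70, 91, 96}. \<not> inside_angle_A (ETC n a b b)"
  by (simp add: ETC_entry etc_defs not_inside_angle_A_bary_of assms
      angA_commute[of b a b])

lemma exceptional_center_not_inside_angle_A:
  assumes "n \<in> {18,26,30,59,68,70,87,90,91,93,96,99,100}"
  obtains a b where "0 < a" "a < b" "\<not> inside_angle_A (ETC n a b b)"
proof -
  consider (apex_pi_6) "n \<in> {18, 93}" | (apex_pi_4) "n \<in> {26, 68, 70, 91, 96}" |
      (base_cosine) "n = 90" | (sides_1_2_2) "n \<in> {30, 59, 87, 99, 100}"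
    using assms by auto
  then show thesis
  proof cases
    case apex_pi_6
    obtain a where "tall_isosceles_triangle a 1" "angA a 1 1 = pi / 6"
      using tall_isosceles_triangle_apex[of "pi / 6"] by auto
    with apex_pi_6 show thesis
      using that[of a 1] not_inside_angle_A_apex_pi_6 tall_isosceles_triangle_def by blast
  next
    case apex_pi_4
    obtain a where "tall_isosceles_triangle a 1" "angA a 1 1 = pi / 4"
      using tall_isosceles_triangle_apex[of "pi / 4"] by auto
    with apex_pi_4 show thesis
      using that[of a 1] not_inside_angle_A_apex_pi_4 tall_isosceles_triangle_def by blast
  next
    case base_cosine
    have sqrt_3_bounds: "1 < sqrt (3::real)" "sqrt (3::real) < 2"
      by (simp_all add: real_less_lsqrt)
    then have "isosceles_triangle (sqrt 3 - 1) 1"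
      by unfold_locales simp_all
    from not_inside_angle_A_ETC_90[OF this] base_cosine sqrt_3_bounds show thesis
      using that[of "sqrt 3 - 1" 1] by simp
  next
    case sides_1_2_2
    then show thesis
      using that[of 1 2] not_inside_angle_A_isosceles[of 1 2] not_inside_angle_A_ETC_30
        not_inside_angle_A_ETC_87 by auto
  qed
qed

theorem theorem2p4:
  shows "(\<forall>n \<in> {1..100} - {18,26,30,59,68,70,87,90,91,93,96,99,100::nat}.
            \<forall>a b c :: real. 0 < a \<and> a < b \<and> b = c \<longrightarrow> inside_angle_A (ETC n a b c))
       \<and> (\<forall>n \<in> {18,26,30,59,68,70,87,90,91,93,96,99,100::nat}.
            \<not> (\<forall>a b c :: real. 0 < a \<and> a < b \<and> b = c \<longrightarrow> inside_angle_A (ETC n a b c)))"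
proof (intro conjI ballI allI impI)
  fix n :: nat and a b c :: real
  assume n: "n \<in> {1..100} - {18,26,30,59,68,70,87,90,91,93,96,99,100}"
    and abc: "0 < a \<and> a < b \<and> b = c"
  then interpret tall_isosceles_triangle a b
    by unfold_locales simp_all
  show "inside_angle_A (ETC n a b c)"
    using unexceptional_center_inside_angle_A[OF n] abc by simp
next
  fix n :: nat
  assume "n \<in> {18,26,30,59,68,70,87,90,91,93,96,99,100}"
  then show "\<not> (\<forall>a b c. 0 < a \<and> a < b \<and> b = c \<longrightarrow> inside_angle_A (ETC n a b c))"
    using exceptional_center_not_inside_angle_A by metis
qed

end
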